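(* Let $n\ge1$ and let $\theta$ be an integer. Let $a$ and $b$ be two elements of $L(n,\theta)$. Then $a\ge_\theta b$ if and only if $a\ge_D b$, where $\ge_D$ is the dominance ordering on compositions of $n$, i.e. $\sum_{j=1}^{i}a_j\ge\sum_{j=1}^{i}b_j$ for all $1\le i\le n$.
   Context: A composition of $n$ is a sequence $a=(a_1,\ldots,a_n)$ of nonnegative integers with $\sum a_i=n$ (not necessarily decreasing, zeros allowed). For an integer $\theta$, a transition $T(\theta)$ transforms a composition $a$ into the composition $(a_1,\ldots,a_i-1,a_{i+1}+1,\ldots,a_n)$ for some $1\le i\le n-1$ with $a_i-a_{i+1}\ge\theta$ (and $a_i\ge1$, so that the result is a composition). $L(n,\theta)$ is the set of all compositions obtained from $N=(n,0,\ldots,0)$ by iterating $T(\theta)$. For $a,b\in L(n,\theta)$, $a\ge_\theta b$ means that $b$ is obtained from $a$ by a (possibly empty) finite sequence of transitions $T(\theta)$. *)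

theory Defs
  imports Main
begin

(* Lists are indexed from 0: the entry a_(i+1) of the mathematical sequence is a ! i. *)

definition compositions :: "nat \<Rightarrow> nat list set" where
  "compositions n = {a. length a = n \<and> (\<Sum>i<n. a ! i) = n}"

(* The difference is taken in int, since \<theta> and the difference may be negative. *)

definition transition :: "int \<Rightarrow> nat list \<Rightarrow> nat list \<Rightarrow> bool" where
  "transition \<theta> a b \<longleftrightarrow>
     (\<exists>i. Suc i < length a \<and> 1 \<le> a ! i \<and> int (a ! i) - int (a ! Suc i) \<ge> \<theta> \<and>
          b = a[i := a ! i - 1, Suc i := a ! Suc i + 1])"

definition theta_ge :: "int \<Rightarrow> nat list \<Rightarrow> nat list \<Rightarrow> bool" where
  "theta_ge \<theta> = (transition \<theta>)\<^sup>*\<^sup>*"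

(* For n \<ge> 1 the starting list is (n, 0, ..., 0) of length n. *)

definition L :: "nat \<Rightarrow> int \<Rightarrow> nat list set" where
  "L n \<theta> = {a. theta_ge \<theta> (n # replicate (n - 1) 0) a}"

definition dominates :: "nat \<Rightarrow> nat list \<Rightarrow> nat list \<Rightarrow> bool" where
  "dominates n a b \<longleftrightarrow> (\<forall>i\<in>{1..n}. (\<Sum>j<i. a ! j) \<ge> (\<Sum>j<i. b ! j))"

lemma transition_compositions:
  assumes "a \<in> compositions n" and "transition \<theta> a b"
  shows "b \<in> compositions n"
proof -
  from assms obtain i where len: "length a = n" and s: "(\<Sum>j<n. a ! j) = n"
    and i: "Suc i < n" "1 \<le> a ! i"
    and b: "b = a[i := a ! i - 1, Suc i := a ! Suc i + 1]"
    by (auto simp: compositions_def transition_def)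
  have split: "(\<Sum>j<n. f j) = f i + (f (Suc i) + (\<Sum>j\<in>{..<n} - {i} - {Suc i}. f j))"
    for f :: "nat \<Rightarrow> nat"
    using i(1) by (simp add: sum.remove[of _ i] sum.remove[of _ "Suc i"])
  have "(\<Sum>j\<in>{..<n} - {i} - {Suc i}. b ! j) = (\<Sum>j\<in>{..<n} - {i} - {Suc i}. a ! j)"
    by (rule sum.cong) (auto simp: b)
  moreover have "b ! i = a ! i - 1" "b ! Suc i = a ! Suc i + 1"
    using i(1) len by (auto simp: b)
  ultimately have "(\<Sum>j<n. b ! j) = (\<Sum>j<n. a ! j)"
    using i(2) by (simp add: split)
  then show ?thesis
    using s len by (simp add: compositions_def b)
qed

lemma L_subset_compositions:
  assumes "1 \<le> n"
  shows "L n \<theta> \<subseteq> compositions n"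
proof
  fix a assume "a \<in> L n \<theta>"
  then have "(transition \<theta>)\<^sup>*\<^sup>* (n # replicate (n - 1) 0) a"
    by (simp add: L_def theta_ge_def)
  then show "a \<in> compositions n"
  proof (induction rule: rtranclp_induct)
    case base
    obtain m where "n = Suc m"
      using assms by (cases n) auto
    then show ?case
      by (simp add: compositions_def sum.lessThan_Suc_shift del: sum.lessThan_Suc)
  next
    case (step y z)
    then show ?case
      using transition_compositions by blast
  qed
qed

end

theory Submission
  imports Defs
begin

text \<open>
  Moving a unit from position \<open>i\<close> to position \<open>i + 1\<close> lowers the single partial sum
  \<open>a\<^sub>1 + \<dots> + a\<^sub>i\<close> by one. Hence lowering the other partial sums, while keeping this one, can only
  help to enable the move. Given a path from \<open>c\<close> to \<open>b\<close> and a composition \<open>a\<close> between them in the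
  dominance order, follow the path until its first step leaves the set of compositions dominating
  \<open>a\<close>. There the partial sums of the path and of \<open>a\<close> at the moved position agree, so the same move
  is enabled at \<open>a\<close>. Performing it keeps \<open>a\<close> between the path and \<open>b\<close>; repeating this leads from
  \<open>a\<close> to \<open>b\<close>.
\<close>

text \<open>The first \<open>k\<close> entries contain position \<open>i\<close> but not
  \<open>Suc i\<close> exactly when \<open>k = Suc i\<close>; otherwise the two changes cancel or
  are both outside. The additive form avoids truncated subtraction.\<close>

lemma sum_nth_transfer:
  fixes a :: "nat list"
  assumes "Suc i < length a" "1 \<le> a ! i"
  shows "(\<Sum>j<k. a ! j) =
    (\<Sum>j<k. a[i := a ! i - 1, Suc i := a ! Suc i + 1] ! j) + (if k = Suc i then 1 else 0)"
proof (induction k)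
  case 0
  then show ?case by simp
next
  case (Suc k)
  then show ?case
    using assms by (cases "k = i"; cases "k = Suc i") (auto simp: nth_list_update)
qed

lemma dominates_refl: "dominates n a a"
  by (simp add: dominates_def)

lemma dominates_trans: "dominates n a b \<Longrightarrow> dominates n b c \<Longrightarrow> dominates n a c"
  unfolding dominates_def using order_trans by blast

lemma dominatesD: "dominates n a b \<Longrightarrow> k \<le> n \<Longrightarrow> (\<Sum>j<k. b ! j) \<le> (\<Sum>j<k. a ! j)"
  by (cases "k = 0") (auto simp: dominates_def)

lemma dominates_antisym:
  assumes "length a = n" "length b = n" "dominates n a b" "dominates n b a"
  shows "a = b"
proof (rule nth_equalityI)
  show "length a = length b" using assms by simp
next
  fix i assume "i < length a"
  then have "(\<Sum>j<k. a ! j) = (\<Sum>j<k. b ! j)" if "k \<le> Suc i" for k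
    using that assms dominatesD[of n a b k] dominatesD[of n b a k] by simp
  from this[of i] this[of "Suc i"] show "a ! i = b ! i" by simp
qed

lemma transition_dominates: "transition \<theta> a b \<Longrightarrow> dominates n a b"
  unfolding transition_def dominates_def using sum_nth_transfer by fastforce

lemma theta_ge_dominates:
  assumes "theta_ge \<theta> a b"
  shows "dominates n a b"
  using assms unfolding theta_ge_def
  by (induction rule: rtranclp_induct)
    (auto intro: dominates_refl dominates_trans transition_dominates)

text \<open>The induction removes the head of the path from \<open>c\<close>; \<open>a\<close> is
  kept arbitrary since it may have to move along with \<open>c\<close>.\<close>

lemma theta_ge_interval:
  assumes "theta_ge \<theta> c b" "b \<in> compositions n" "c \<in> compositions n" "a \<in> compositions n"
    and "dominates n c a" "dominates n a b"
  shows "theta_ge \<theta> a b"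
  using assms unfolding theta_ge_def
proof (induction arbitrary: a rule: converse_rtranclp_induct)
  case base
  then have "a = b" by (intro dominates_antisym) (auto simp: compositions_def)
  then show ?case by simp
next
  case (step c c')
  have c': "c' \<in> compositions n"
    using step.hyps(1) step.prems(2) by (rule transition_compositions[rotated])
  show ?case
  proof (cases "dominates n c' a")
    case True
    then show ?thesis using step c' by blast
  next
    case False
    from step.hyps(1) step.prems(2) obtain i where i: "Suc i < n" "1 \<le> c ! i"
      and \<theta>: "int (c ! i) - int (c ! Suc i) \<ge> \<theta>"
      and c'_eq: "c' = c[i := c ! i - 1, Suc i := c ! Suc i + 1]"
      and len: "length c = n"
      by (auto simp: transition_def compositions_def)
    have c_sum: "(\<Sum>j<k. c ! j) = (\<Sum>j<k. c' ! j) + (if k = Suc i then 1 else 0)" for k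
      unfolding c'_eq using i len by (intro sum_nth_transfer) auto
    have le: "(\<Sum>j<k. a ! j) \<le> (\<Sum>j<k. c ! j)" if "k \<le> n" for k
      using step.prems(4) that by (rule dominatesD)
    \<comment> \<open>Passing to \<open>c'\<close> costs one unit in this partial sum only, so
      dominance over \<open>a\<close> can be lost only if there was no slack here.\<close>
    have eq: "(\<Sum>j<Suc i. a ! j) = (\<Sum>j<Suc i. c ! j)"
    proof -
      from False obtain k where k: "k \<le> n" "(\<Sum>j<k. c' ! j) < (\<Sum>j<k. a ! j)"
        by (auto simp: dominates_def not_le)
      then have "k = Suc i" "(\<Sum>j<k. a ! j) = (\<Sum>j<k. c ! j)"
        using c_sum[of k] le[of k] by (auto split: if_splits)
      then show ?thesis by simp
    qed
    \<comment> \<open>Entries are differences of consecutive partial sums: equality in the middle,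
      \<open>le\<close> on either side.\<close>
    have "c ! i \<le> a ! i" "a ! Suc i \<le> c ! Suc i"
      using eq le[of i] le[of "Suc (Suc i)"] i(1) by auto
    then have ai: "1 \<le> a ! i" "int (a ! i) - int (a ! Suc i) \<ge> \<theta>"
      using i(2) \<theta> by linarith+
    define a' where "a' = a[i := a ! i - 1, Suc i := a ! Suc i + 1]"
    have len_a: "length a = n" using step.prems(3) by (simp add: compositions_def)
    have a_sum: "(\<Sum>j<k. a ! j) = (\<Sum>j<k. a' ! j) + (if k = Suc i then 1 else 0)" for k
      unfolding a'_def using i(1) ai(1) len_a by (intro sum_nth_transfer) auto
    have tr: "transition \<theta> a a'"
      unfolding transition_def a'_def using i(1) ai len_a by blast
    have a': "a' \<in> compositions n"
      using step.prems(3) tr by (rule transition_compositions)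
    have "dominates n c' a'"
      unfolding dominates_def
    proof
      fix k assume "k \<in> {1..n}"
      then show "(\<Sum>j<k. a' ! j) \<le> (\<Sum>j<k. c' ! j)"
        using le[of k] a_sum[of k] c_sum[of k] by simp
    qed
    moreover have "dominates n a' b"
      unfolding dominates_def
    proof
      fix k assume k: "k \<in> {1..n}"
      \<comment> \<open>At \<open>k = Suc i\<close> the sums of \<open>a'\<close> and
        \<open>c'\<close> coincide by \<open>eq\<close>, so the bound comes from \<open>c'\<close>;
        at every other \<open>k\<close> it comes from \<open>a\<close>.\<close>
      have "dominates n c' b"
        using step.hyps(2) by (intro theta_ge_dominates) (simp add: theta_ge_def)
      then show "(\<Sum>j<k. b ! j) \<le> (\<Sum>j<k. a' ! j)"
        using k eq a_sum[of k] c_sum[of k] dominatesD[of n c' b k] dominatesD[of n a b k]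
          step.prems(5)
        by (cases "k = Suc i") simp_all
    qed
    ultimately have "(transition \<theta>)\<^sup>*\<^sup>* a' b"
      using step.IH step.prems(1) c' a' by blast
    with tr show ?thesis by (rule converse_rtranclp_into_rtranclp)
  qed
qed

theorem theorem6:
  fixes n :: nat and \<theta> :: int and a b :: "nat list"
  assumes "n \<ge> 1"
    and "a \<in> L n \<theta>"
    and "b \<in> L n \<theta>"
  shows "theta_ge \<theta> a b \<longleftrightarrow> dominates n a b"
proof
  assume "theta_ge \<theta> a b"
  then show "dominates n a b" by (rule theta_ge_dominates)
next
  assume dom: "dominates n a b"
  let ?N = "n # replicate (n - 1) 0"
  have "theta_ge \<theta> ?N a" "theta_ge \<theta> ?N b"
    using assms by (auto simp: L_def)
  moreover have "?N \<in> compositions n"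
    using L_subset_compositions[OF assms(1), of \<theta>] by (auto simp: L_def theta_ge_def)
  moreover have "a \<in> compositions n" "b \<in> compositions n"
    using L_subset_compositions assms by blast+
  \<comment> \<open>The path to follow is the one from \<open>?N\<close> to \<open>b\<close>; the
    path from \<open>?N\<close> to \<open>a\<close> only supplies dominance of \<open>?N\<close>
    over \<open>a\<close>.\<close>
  ultimately show "theta_ge \<theta> a b"
    using dom theta_ge_interval theta_ge_dominates by blast
qed

end
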